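(* Let $G$ be a graph with bounded degree, and let $v$ and $w$ be fixed vertices in $G$ such that $t^*=t^*_G(v,w)<\infty$. Suppose there is a permutation $\sigma$ of the vertices of $G$ such that, for all vertices $x\in G$, $$(v,x)\cong(\sigma(x),w)\quad\text{and}\quad(x,w)\cong(v,\sigma(x)),$$ where $(v_1,v_2)\cong(w_1,w_2)$ denotes that $G$ has a graph automorphism $\varphi$ such that $\varphi(v_1)=w_1$ and $\varphi(v_2)=w_2$. Then $f_G^{vw}(s,t)\le0$ for all $s,t\ge 0$ with $s+t\le t^*$.
   Context: Graphs: all graphs have a finite or countably infinite vertex set, bounded degree and no loops; they may have a mixture of directed and undirected edges and may have multiple edges between the same pair of vertices (a graph automorphism preserves edge types, directions and multiplicities). A path from $v$ to $w$ is a finite sequence of consecutive edges leading from $v$ to $w$ (directed edges traversed along their direction); vertices and edges may be repeated. $|\gamma|$ is the number of edges of $\gamma$ counted with multiplicity; when $v=w$ the trivial path of length $0$ is included. $\Gamma_H(v,w)$ is the set of all paths from $v$ to $w$ in $H$. Generating function: $m_H(v,w,t)=\sum_{\gamma\in\Gamma_H(v,w)}\frac{t^{|\gamma|}}{|\gamma|!}$ for $t\ge0$ (with $t^0/0!=1$ also at $t=0$). The critical time $t^*_G(v,w)$ is the solution $t\ge0$ of $m_G(v,w,t)=1$ (unique if $v\ne w$ and a path from $v$ to $w$ exists; if $v=w$ the least solution, $0$, is taken); $t^*_G(v,w)=\infty$ if there is no path from $v$ to $w$. For $s,t\ge0$ with $s+t\le t^*=t^*_G(v,w)<\infty$, $$f_G^{vw}(s,t)=\sum_{x,y\in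 G}m_G(v,x,s)\,m_G(x,y,t)\,m_G(y,w,t^*-s-t)\,\ln\left(m_G(x,y,t)\right),$$ where any term of the form $0\ln0$ is interpreted as $0$. *)

theory Defs
  imports "HOL-Analysis.Infinite_Sum" "HOL-Library.Extended_Real" "HOL-Library.Uprod"
begin

text \<open>An edge is either directed, with a tail and a head, or undirected, with an unordered pair
  of end vertices. Multiple edges are distinct edge names with the same ends.\<close>

datatype 'v ends = Directed 'v 'v | Undirected "'v uprod"

record ('v, 'e) mixed_graph =
  verts :: "'v set"
  edges :: "'e set"
  ends :: "'e \<Rightarrow> 'v ends"

definition incident_edges :: "('v, 'e) mixed_graph \<Rightarrow> 'v \<Rightarrow> 'e set" where
  "incident_edges G x = {e \<in> edges G. x \<in> set_ends (ends G e)}"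

locale bounded_degree_graph =
  fixes G :: "('v, 'e) mixed_graph"
  assumes countable_verts: "countable (verts G)"
    and ends_in_verts: "\<And>e. e \<in> edges G \<Longrightarrow> set_ends (ends G e) \<subseteq> verts G"
    and no_directed_loop: "\<And>e x. e \<in> edges G \<Longrightarrow> ends G e \<noteq> Directed x x"
    and no_undirected_loop: "\<And>e x. e \<in> edges G \<Longrightarrow> ends G e \<noteq> Undirected (Upair x x)"
    and bounded_degree:
      "\<exists>d::nat. \<forall>x\<in>verts G. finite (incident_edges G x) \<and> card (incident_edges G x) \<le> d"

text \<open>A path is recorded by its list of edges: since there are no loops, the start vertex and the
  edges determine all visited vertices.\<close>

definition traverses :: "('v, 'e) mixed_graph \<Rightarrow> 'v \<Rightarrow> 'e \<Rightarrow> 'v \<Rightarrow> bool" where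
  "traverses G x e y \<longleftrightarrow>
     e \<in> edges G \<and> (ends G e = Directed x y \<or> ends G e = Undirected (Upair x y))"

primrec is_path :: "('v, 'e) mixed_graph \<Rightarrow> 'v \<Rightarrow> 'e list \<Rightarrow> 'v \<Rightarrow> bool" where
  "is_path G x [] y \<longleftrightarrow> x \<in> verts G \<and> x = y"
| "is_path G x (e # es) y \<longleftrightarrow> (\<exists>z. traverses G x e z \<and> is_path G z es y)"

definition paths :: "('v, 'e) mixed_graph \<Rightarrow> 'v \<Rightarrow> 'v \<Rightarrow> 'e list set" where
  "paths G v w = {\<gamma>. is_path G v \<gamma> w}"

text \<open>For \<open>t \<ge> 0\<close> the series converges, as a graph of maximum degree \<open>d\<close> has at most \<open>d ^ n\<close>
  paths of length \<open>n\<close> from a given vertex.\<close>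

definition path_gf :: "('v, 'e) mixed_graph \<Rightarrow> 'v \<Rightarrow> 'v \<Rightarrow> real \<Rightarrow> real" where
  "path_gf G v w t = (\<Sum>\<^sub>\<infinity>\<gamma>\<in>paths G v w. t ^ length \<gamma> / fact (length \<gamma>))"

text \<open>For \<open>v \<noteq> w\<close> with a path from \<open>v\<close> to \<open>w\<close> the solution is unique, because the
  generating function is continuous and increases strictly from \<open>0\<close> to \<open>\<infinity>\<close>; for \<open>v = w\<close>
  the least solution is \<open>0\<close>.\<close>

definition critical_time :: "('v, 'e) mixed_graph \<Rightarrow> 'v \<Rightarrow> 'v \<Rightarrow> ereal" where
  "critical_time G v w =
     (if paths G v w = {} then \<infinity> else ereal (LEAST t. 0 \<le> t \<and> path_gf G v w t = 1))"

text \<open>Terms with \<open>path_gf G x y t = 0\<close> vanish through that factor, which is the convention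
  \<open>0 ln 0 = 0\<close>. The definition is meant for \<open>s, t \<ge> 0\<close> and \<open>s + t \<le> critical_time G v w < \<infinity>\<close>; the
  double series then converges absolutely by the bounded degree.\<close>

definition entropy_sum :: "('v, 'e) mixed_graph \<Rightarrow> 'v \<Rightarrow> 'v \<Rightarrow> real \<Rightarrow> real \<Rightarrow> real" where
  "entropy_sum G v w s t =
     (\<Sum>\<^sub>\<infinity>(x, y)\<in>verts G \<times> verts G.
        path_gf G v x s * path_gf G x y t *
        path_gf G y w (real_of_ereal (critical_time G v w) - s - t) * ln (path_gf G x y t))"

definition automorphism :: "('v, 'e) mixed_graph \<Rightarrow> ('v \<Rightarrow> 'v) \<Rightarrow> bool" where
  "automorphism G \<phi> \<longleftrightarrow> bij_betw \<phi> (verts G) (verts G) \<and>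
     (\<forall>x\<in>verts G. \<forall>y\<in>verts G.
        card {e \<in> edges G. ends G e = Directed (\<phi> x) (\<phi> y)} =
          card {e \<in> edges G. ends G e = Directed x y} \<and>
        card {e \<in> edges G. ends G e = Undirected (Upair (\<phi> x) (\<phi> y))} =
          card {e \<in> edges G. ends G e = Undirected (Upair x y)})"

definition pair_equiv :: "('v, 'e) mixed_graph \<Rightarrow> 'v \<times> 'v \<Rightarrow> 'v \<times> 'v \<Rightarrow> bool" where
  "pair_equiv G p q \<longleftrightarrow> (\<exists>\<phi>. automorphism G \<phi> \<and> \<phi> (fst p) = fst q \<and> \<phi> (snd p) = snd q)"

end

theory Submission
  imports Defs "HOL-Analysis.Analysis"
begin

text \<open>
  Write \<open>m x y t\<close> for the generating function and \<open>T\<close> for the critical time, so that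
  \<open>m v w T = 1\<close>.  Cutting paths gives the Chapman--Kolmogorov identity
  \<open>\<Sum>y. m x y s * m y z t = m x z (s + t)\<close>.  Hence, for \<open>s + t + u = T\<close>, the weights
  \<open>m v x s * m x y t * m y w u\<close> form a probability distribution: the positions \<open>X\<close> and \<open>Y\<close>
  at times \<open>s\<close> and \<open>s + t\<close> of a bridge which runs from \<open>v\<close> to \<open>w\<close> during time \<open>T\<close>.  The sum
  in question is the expectation of \<open>ln (m X Y t)\<close>.

  The symmetry makes this expectation independent of \<open>s\<close>.  Cut the bridge
  \<open>v \<rightarrow> z \<rightarrow> w\<close> at some time and exchange the pieces: the second one is equivalent to a piece
  \<open>v \<rightarrow> \<sigma> z\<close>, the first one to a piece \<open>\<sigma> z \<rightarrow> w\<close>, and \<open>\<sigma>\<close> permutes the possible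
  \<open>z\<close>.  So a window of length \<open>t\<close> at the start of the bridge may be moved to any other place
  (\<open>has_sum_log_mean_middle\<close>), and the expectation is a function \<open>log_mean\<close> of \<open>t\<close> alone.

  This function is superadditive on the circle of circumference \<open>T\<close>.  If \<open>a + b \<le> T\<close>, two
  adjacent windows of lengths \<open>a\<close> and \<open>b\<close> together form one of length \<open>a + b\<close>, and
  \<open>m v x a * m x y b \<le> m v y (a + b)\<close> (\<open>log_mean_superadditive\<close>).  If \<open>T \<le> a + b\<close>, put one
  window at the start and one at the end; they overlap in a window of length \<open>a + b - T\<close>.  The
  joint law of \<open>X\<close> and \<open>Y\<close>, the two ends of the overlap, divided by the product of the marginal
  laws is \<open>m X Y (a + b - T) / (m v Y a * m X w b)\<close>, so nonnegativity of the mutual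
  information of \<open>X\<close> and \<open>Y\<close> is the inequality
  \<open>log_mean a + log_mean b \<le> log_mean (a + b - T)\<close> (\<open>log_mean_superadditive_wrapped\<close>).

  Consequently \<open>2 * log_mean t \<le> log_mean t'\<close> with \<open>t'\<close> the residue of \<open>2 * t\<close> modulo \<open>T\<close>.
  Bounded degree gives one upper bound \<open>C\<close> for all values of \<open>log_mean\<close>; doubling the time
  \<open>n\<close> times improves it to \<open>C / 2 ^ n\<close>, and therefore \<open>log_mean \<le> 0\<close>.
\<close>

section \<open>Weighted double sums\<close>

lemma has_sum_Sigma_nonneg:
  fixes f :: "'a \<Rightarrow> 'b \<Rightarrow> real"
  assumes inner: "\<And>x. x \<in> A \<Longrightarrow> (f x has_sum g x) (B x)"
    and outer: "(g has_sum S) A"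
    and nonneg: "\<And>x y. x \<in> A \<Longrightarrow> y \<in> B x \<Longrightarrow> 0 \<le> f x y"
  shows "((\<lambda>(x, y). f x y) has_sum S) (Sigma A B)"
proof (rule has_sum_SigmaI)
  show "(\<lambda>(x, y). f x y) summable_on Sigma A B"
    by (rule summable_on_SigmaI[where g = g])
       (use assms in \<open>auto intro: has_sum_imp_summable\<close>)
qed (use assms in auto)

text \<open>The factor \<open>g\<close> may change sign, so that the order of summation matters a priori;
  since it depends on the first coordinate only, absolute convergence can be read off from the
  marginal sums.\<close>

lemma has_sum_marginal:
  fixes p :: "'a \<Rightarrow> 'b \<Rightarrow> real"
  assumes marginal: "\<And>x. x \<in> A \<Longrightarrow> (p x has_sum q x) B"
    and nonneg: "\<And>x y. x \<in> A \<Longrightarrow> y \<in> B \<Longrightarrow> 0 \<le> p x y"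
    and summable: "(\<lambda>x. q x * g x) summable_on A"
  shows "((\<lambda>(x, y). p x y * g x) has_sum (\<Sum>\<^sub>\<infinity>x\<in>A. q x * g x)) (A \<times> B)"
proof (rule has_sum_SigmaI)
  have q: "0 \<le> q x" if "x \<in> A" for x
    using marginal[OF that] by (rule has_sum_nonneg) (use nonneg that in auto)
  have "(\<lambda>x. \<bar>q x * g x\<bar>) summable_on A"
    using summable summable_on_iff_abs_summable_on_real[of "\<lambda>x. q x * g x" A] by simp
  then have "(\<lambda>x. q x * \<bar>g x\<bar>) summable_on A"
    by (rule summable_on_cong[THEN iffD1, rotated]) (simp add: abs_mult q)
  then have "(\<lambda>(x, y). p x y * \<bar>g x\<bar>) summable_on A \<times> B"
    by (intro summable_on_SigmaI[where g = "\<lambda>x. q x * \<bar>g x\<bar>"])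
       (auto intro!: has_sum_cmult_left marginal mult_nonneg_nonneg nonneg)
  moreover have "\<bar>case z of (x, y) \<Rightarrow> p x y * g x\<bar> = (case z of (x, y) \<Rightarrow> p x y * \<bar>g x\<bar>)"
    if "z \<in> A \<times> B" for z
    using that nonneg by (auto simp: abs_mult)
  ultimately have "(\<lambda>z. \<bar>case z of (x, y) \<Rightarrow> p x y * g x\<bar>) summable_on A \<times> B"
    by (simp cong: summable_on_cong)
  then show "(\<lambda>(x, y). p x y * g x) summable_on A \<times> B"
    using summable_on_iff_abs_summable_on_real[of "\<lambda>(x, y). p x y * g x" "A \<times> B"] by simp
next
  show "((\<lambda>x. q x * g x) has_sum (\<Sum>\<^sub>\<infinity>x\<in>A. q x * g x)) A"
    using summable by (rule has_sum_infsum)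
qed (use marginal in \<open>auto intro!: has_sum_cmult_left\<close>)

lemma has_sum_marginal_snd:
  fixes p :: "'a \<Rightarrow> 'b \<Rightarrow> real"
  assumes "\<And>y. y \<in> B \<Longrightarrow> ((\<lambda>x. p x y) has_sum q y) A"
    and "\<And>x y. x \<in> A \<Longrightarrow> y \<in> B \<Longrightarrow> 0 \<le> p x y"
    and "(\<lambda>y. q y * g y) summable_on B"
  shows "((\<lambda>(x, y). p x y * g y) has_sum (\<Sum>\<^sub>\<infinity>y\<in>B. q y * g y)) (A \<times> B)"
  using has_sum_marginal[where p = "\<lambda>y x. p x y" and A = B and B = A and q = q and g = g] assms
  by (subst has_sum_swap) auto


section \<open>Paths and their generating function\<close>

lemma traverses_unique: "traverses G x e y \<Longrightarrow> traverses G x e z \<Longrightarrow> y = z"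
  by (auto simp: traverses_def)

lemma is_path_unique_end: "is_path G x \<gamma> y \<Longrightarrow> is_path G x \<gamma> z \<Longrightarrow> y = z"
  by (induction \<gamma> arbitrary: x) (auto dest: traverses_unique)

context bounded_degree_graph
begin

abbreviation V :: "'v set" where "V \<equiv> verts G"
abbreviation m :: "'v \<Rightarrow> 'v \<Rightarrow> real \<Rightarrow> real" where "m \<equiv> path_gf G"

lemma traverses_verts: "traverses G x e y \<Longrightarrow> x \<in> V \<and> y \<in> V"
  using ends_in_verts by (force simp: traverses_def)

lemma is_path_verts: "is_path G x \<gamma> y \<Longrightarrow> x \<in> V \<and> y \<in> V"
  by (induction \<gamma> arbitrary: x) (auto dest: traverses_verts)

lemma is_path_append:
  "is_path G x (\<gamma> @ \<delta>) z \<longleftrightarrow> (\<exists>y. is_path G x \<gamma> y \<and> is_path G y \<delta> z)"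
  by (induction \<gamma> arbitrary: x) (auto dest: is_path_verts)

definition walks :: "'v \<Rightarrow> nat \<Rightarrow> 'e list set" where
  "walks x n = {\<gamma>. length \<gamma> = n \<and> (\<exists>y. is_path G x \<gamma> y)}"

definition degree_bound :: nat where
  "degree_bound = (SOME d. \<forall>x\<in>V. finite (incident_edges G x) \<and> card (incident_edges G x) \<le> d)"

lemma degree_le: "x \<in> V \<Longrightarrow> finite (incident_edges G x) \<and> card (incident_edges G x) \<le> degree_bound"
  unfolding degree_bound_def using someI_ex[OF bounded_degree] by blast

lemma card_walks_le: "finite (walks x n) \<and> card (walks x n) \<le> degree_bound ^ n"
proof (induction n arbitrary: x)
  case 0
  have "walks x 0 \<subseteq> {[]}" by (auto simp: walks_def)
  then show ?case
    using card_mono[of "{[]}" "walks x 0"] by (auto intro: finite_subset)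
next
  case (Suc n)
  show ?case
  proof (cases "x \<in> V")
    case False
    then have "walks x (Suc n) = {}"
      by (auto simp: walks_def dest: is_path_verts)
    then show ?thesis by simp
  next
    case True
    \<comment> \<open>An edge that can be left from \<open>x\<close> determines the vertex that it leads to.\<close>
    define far where "far e = (THE z. traverses G x e z)" for e
    have far: "far e = z" if "traverses G x e z" for e z
      unfolding far_def using that by (auto dest: traverses_unique)
    let ?U = "\<Union>e\<in>incident_edges G x. (#) e ` walks (far e) n"
    have sub: "walks x (Suc n) \<subseteq> ?U"
    proof
      fix \<gamma> assume "\<gamma> \<in> walks x (Suc n)"
      then obtain e \<delta> y z where \<gamma>: "\<gamma> = e # \<delta>" "length \<delta> = n" "traverses G x e z" "is_path G z \<delta> y"
        by (auto simp: walks_def length_Suc_conv)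
      then have "e \<in> incident_edges G x"
        by (auto simp: incident_edges_def traverses_def)
      moreover have "\<delta> \<in> walks (far e) n"
        using \<gamma> far by (auto simp: walks_def)
      ultimately show "\<gamma> \<in> ?U"
        using \<gamma> by blast
    qed
    have fin: "finite ?U"
      using degree_le[OF True] Suc by auto
    have "card ?U \<le> (\<Sum>e\<in>incident_edges G x. card ((#) e ` walks (far e) n))"
      using degree_le[OF True] by (intro card_UN_le) auto
    also have "\<dots> \<le> (\<Sum>e\<in>incident_edges G x. degree_bound ^ n)"
      using Suc by (intro sum_mono) (simp add: card_image)
    also have "\<dots> \<le> degree_bound * degree_bound ^ n"
      using degree_le[OF True] by simp
    finally show ?thesis
      using sub fin card_mono[OF fin sub] by (auto intro: finite_subset)
  qed
qed

text \<open>There are at most \<open>degree_bound ^ n\<close> paths of length \<open>n\<close> from \<open>x\<close>, so any finite part of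
  the generating function is dominated by the exponential series.\<close>

lemma sum_path_weights_le:
  assumes t: "0 \<le> t" and F: "finite F" "F \<subseteq> paths G x y"
  shows "(\<Sum>\<gamma>\<in>F. t ^ length \<gamma> / fact (length \<gamma>)) \<le> exp (real degree_bound * t)"
proof -
  obtain N where N: "\<And>\<gamma>. \<gamma> \<in> F \<Longrightarrow> length \<gamma> < N"
    using finite_nat_set_iff_bounded[of "length ` F"] F by auto
  have "(\<Sum>\<gamma>\<in>F. t ^ length \<gamma> / fact (length \<gamma>))
      \<le> (\<Sum>\<gamma>\<in>(\<Union>n<N. walks x n). t ^ length \<gamma> / fact (length \<gamma>))"
    using F N t card_walks_le by (intro sum_mono2) (auto simp: walks_def paths_def)
  also have "\<dots> = (\<Sum>n<N. \<Sum>\<gamma>\<in>walks x n. t ^ length \<gamma> / fact (length \<gamma>))"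
    using card_walks_le by (intro sum.UNION_disjoint) (auto simp: walks_def)
  also have "\<dots> = (\<Sum>n<N. real (card (walks x n)) * (t ^ n / fact n))"
    by (intro sum.cong refl) (simp add: walks_def)
  also have "\<dots> \<le> (\<Sum>n<N. (real degree_bound * t) ^ n / fact n)"
  proof (intro sum_mono)
    fix n
    have "real (card (walks x n)) * (t ^ n / fact n) \<le> real degree_bound ^ n * (t ^ n / fact n)"
      using card_walks_le[of x n] t by (intro mult_right_mono) (auto simp flip: of_nat_power)
    then show "real (card (walks x n)) * (t ^ n / fact n) \<le> (real degree_bound * t) ^ n / fact n"
      by (simp add: power_mult_distrib)
  qed
  also have "\<dots> \<le> exp (real degree_bound * t)"
  proof (rule finite_sum_le_has_sum)
    have "((\<lambda>n. (real degree_bound * t) ^ n /\<^sub>R fact n) has_sum exp (real degree_bound * t)) UNIV"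
      using t by (intro sums_nonneg_imp_has_sum exp_converges) auto
    then show "((\<lambda>n. (real degree_bound * t) ^ n / fact n) has_sum exp (real degree_bound * t)) UNIV"
      by (simp add: divide_inverse_commute)
  qed (use t in auto)
  finally show ?thesis .
qed

lemma has_sum_path_gf:
  assumes "0 \<le> t"
  shows "((\<lambda>\<gamma>. t ^ length \<gamma> / fact (length \<gamma>)) has_sum m x y t) (paths G x y)"
  unfolding path_gf_def
proof (intro has_sum_infsum nonneg_bdd_above_summable_on)
  show "bdd_above (sum (\<lambda>\<gamma>. t ^ length \<gamma> / fact (length \<gamma>)) ` {F. F \<subseteq> paths G x y \<and> finite F})"
    by (rule bdd_aboveI2[where M = "exp (real degree_bound * t)"]) (use sum_path_weights_le[OF assms] in blast)
qed (use assms in simp)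

lemma path_gf_le_exp: "0 \<le> t \<Longrightarrow> m x y t \<le> exp (real degree_bound * t)"
  by (rule has_sum_le_finite_sums[OF has_sum_path_gf]) (auto intro: sum_path_weights_le)

lemma path_gf_nonneg: "0 \<le> t \<Longrightarrow> 0 \<le> m x y t"
  unfolding path_gf_def by (intro infsum_nonneg) auto

lemma path_gf_ge_term:
  assumes "0 \<le> t" "\<gamma> \<in> paths G x y"
  shows "t ^ length \<gamma> / fact (length \<gamma>) \<le> m x y t"
proof -
  have "(\<Sum>\<gamma>\<in>{\<gamma>}. t ^ length \<gamma> / fact (length \<gamma>)) \<le> m x y t"
    using assms by (intro finite_sum_le_has_sum[OF has_sum_path_gf]) auto
  then show ?thesis by simp
qed

lemma path_gf_at_0: "m x y 0 = (if x = y \<and> x \<in> V then 1 else 0)"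
proof -
  have "m x y 0 = (\<Sum>\<^sub>\<infinity>\<gamma>\<in>paths G x y \<inter> {[]}. 1)"
    unfolding path_gf_def by (intro infsum_cong_neutral) auto
  also have "\<dots> = (if x = y \<and> x \<in> V then 1 else 0)"
    by (cases "x = y \<and> x \<in> V") (auto simp: paths_def Int_absorb1)
  finally show ?thesis .
qed

text \<open>Cutting a path at each of its vertices in turn: a path of length \<open>n\<close> is cut into
  pieces of lengths \<open>i\<close> and \<open>n - i\<close>, and the binomial theorem adds up the weights of the
  cuts to \<open>(s + t) ^ n / n!\<close>.\<close>

lemma chapman_kolmogorov:
  assumes s: "0 \<le> s" and t: "0 \<le> t"
  shows "((\<lambda>y. m x y s * m y z t) has_sum m x z (s + t)) V"
proof -
  let ?w = "\<lambda>r \<gamma>. r ^ length \<gamma> / fact (length \<gamma>) :: real"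
  let ?C = "\<lambda>(\<epsilon>, i). ?w s (take i \<epsilon>) * ?w t (drop i \<epsilon>)"
  have cuts: "(\<Sum>i\<le>length \<epsilon>. ?w s (take i \<epsilon>) * ?w t (drop i \<epsilon>)) = ?w (s + t) \<epsilon>" for \<epsilon> :: "'e list"
  proof -
    have "?w s (take i \<epsilon>) * ?w t (drop i \<epsilon>)
        = (of_nat (length \<epsilon> choose i) * s ^ i * t ^ (length \<epsilon> - i)) / fact (length \<epsilon>)"
      if "i \<le> length \<epsilon>" for i
      using that by (simp add: binomial_fact min_def)
    then show ?thesis
      by (simp add: binomial_ring sum_divide_distrib)
  qed
  have cut_sum: "(?C has_sum m x z (s + t)) (Sigma (paths G x z) (\<lambda>\<epsilon>. {..length \<epsilon>}))"
  proof (rule has_sum_Sigma_nonneg)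
    show "((\<lambda>i. ?w s (take i \<epsilon>) * ?w t (drop i \<epsilon>)) has_sum ?w (s + t) \<epsilon>) {..length \<epsilon>}"
      for \<epsilon> :: "'e list"
      by (rule has_sum_finiteI) (simp_all only: cuts finite_atMost)
    show "(?w (s + t) has_sum m x z (s + t)) (paths G x z)"
      using s t by (intro has_sum_path_gf) simp
  qed (use s t in simp)
  let ?f = "\<lambda>(y, \<gamma>, \<delta>). (\<gamma> @ \<delta>, length \<gamma>)"
  let ?S = "Sigma V (\<lambda>y. paths G x y \<times> paths G y z)"
  let ?T = "Sigma (paths G x z) (\<lambda>\<epsilon>. {..length \<epsilon>})"
  have bij: "bij_betw ?f ?S ?T"
  proof (rule bij_betw_imageI)
    show "inj_on ?f ?S"
    proof (rule inj_onI)
      fix p q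
      assume *: "p \<in> ?S" "q \<in> ?S" "?f p = ?f q"
      obtain y \<gamma> \<delta> y' \<gamma>' \<delta>' where pq: "p = (y, \<gamma>, \<delta>)" "q = (y', \<gamma>', \<delta>')"
        by (metis prod_cases3)
      with * have "\<gamma> @ \<delta> = \<gamma>' @ \<delta>'" "length \<gamma> = length \<gamma>'" by auto
      with * pq show "p = q"
        using is_path_unique_end[of G x \<gamma> y y'] by (simp add: paths_def)
    qed
    have cut: thesis
      if "is_path G x \<epsilon> z" "i \<le> length \<epsilon>"
        and *: "\<And>y \<gamma> \<delta>. is_path G x \<gamma> y \<Longrightarrow> is_path G y \<delta> z \<Longrightarrow> y \<in> V \<Longrightarrow> \<epsilon> = \<gamma> @ \<delta> \<Longrightarrow>
          i = length \<gamma> \<Longrightarrow> thesis"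
      for \<epsilon> i thesis
    proof -
      have "is_path G x (take i \<epsilon> @ drop i \<epsilon>) z" using that by simp
      then obtain y where "is_path G x (take i \<epsilon>) y" "is_path G y (drop i \<epsilon>) z"
        unfolding is_path_append by blast
      then show ?thesis
        using that(2) is_path_verts by (intro *[of "take i \<epsilon>" y "drop i \<epsilon>"]) auto
    qed
    have "p \<in> ?f ` ?S" if "p \<in> ?T" for p
    proof -
      obtain \<epsilon> i where p: "p = (\<epsilon>, i)" by (cases p)
      with that have "is_path G x \<epsilon> z" "i \<le> length \<epsilon>" by (simp_all add: paths_def)
      then obtain y \<gamma> \<delta> where "is_path G x \<gamma> y" "is_path G y \<delta> z" "y \<in> V"
        and split: "\<epsilon> = \<gamma> @ \<delta>" "i = length \<gamma>"
        by (elim cut)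
      then have "(y, \<gamma>, \<delta>) \<in> ?S" by (simp add: paths_def)
      then have "?f (y, \<gamma>, \<delta>) \<in> ?f ` ?S" by (rule imageI)
      then show ?thesis using p split by simp
    qed
    moreover have "?f p \<in> ?T" if "p \<in> ?S" for p
      using that is_path_append[of x _ _ z] by (cases p) (auto simp: paths_def)
    ultimately show "?f ` ?S = ?T" by blast
  qed
  have whole: "((\<lambda>(y, \<gamma>, \<delta>). ?w s \<gamma> * ?w t \<delta>) has_sum m x z (s + t))
      (Sigma V (\<lambda>y. paths G x y \<times> paths G y z))"
    using has_sum_reindex_bij_betw[OF bij, of ?C "m x z (s + t)"] cut_sum
    by (simp add: case_prod_unfold)
  have pieces: "((\<lambda>(\<gamma>, \<delta>). ?w s \<gamma> * ?w t \<delta>) has_sum m x y s * m y z t)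
      (paths G x y \<times> paths G y z)" for y
  proof (rule has_sum_Sigma_nonneg)
    show "((\<lambda>\<delta>. ?w s \<gamma> * ?w t \<delta>) has_sum ?w s \<gamma> * m y z t) (paths G y z)" for \<gamma> :: "'e list"
      using t by (intro has_sum_cmult_right has_sum_path_gf)
    show "((\<lambda>\<gamma>. ?w s \<gamma> * m y z t) has_sum m x y s * m y z t) (paths G x y)"
      using s by (intro has_sum_cmult_left has_sum_path_gf)
  qed (use s t in auto)
  show ?thesis
    by (rule has_sum_SigmaD[OF whole]) (simp only: prod.case, rule pieces)
qed

lemma path_gf_mult_le:
  assumes "0 \<le> s" "0 \<le> t" "y \<in> V"
  shows "m x y s * m y z t \<le> m x z (s + t)"
proof -
  have "(\<Sum>y\<in>{y}. m x y s * m y z t) \<le> m x z (s + t)"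
    using assms by (intro finite_sum_le_has_sum[OF chapman_kolmogorov]) (auto simp: path_gf_nonneg)
  then show ?thesis by simp
qed

text \<open>The entropy sums converge because \<open>m ln m\<close> at time \<open>t\<close> is dominated by the generating
  function at time \<open>2 t\<close>.  The generating function is at least the term of each single path,
  so \<open>- ln m\<close> grows at most quadratically in the length of a path; the factor
  \<open>2 ^ length \<gamma>\<close> gained by doubling the time absorbs this.\<close>

lemma path_gf_ln_bound:
  assumes t: "0 \<le> t"
  obtains K where "\<And>x y. \<bar>m x y t * ln (m x y t)\<bar> \<le> K * m x y (2 * t)"
proof -
  show thesis
  proof (cases "t = 0")
    case True
    then have "\<bar>m x y t * ln (m x y t)\<bar> \<le> 0 * m x y (2 * t)" for x y
      by (simp add: path_gf_at_0)
    then show thesis by (rule that)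
  next
    case False
    with t have t: "0 < t" by simp
    \<comment> \<open>The first summand is for values of \<open>m\<close> above \<open>1\<close>, the others are for values below.\<close>
    define K where "K = real degree_bound * t + 2 + \<bar>ln t\<bar>"
    have K: "0 \<le> K" unfolding K_def using t by simp
    have quad: "real (n * n) \<le> 2 * 2 ^ n" for n
    proof -
      have *: "n * n \<le> 2 * 2 ^ n \<and> 2 * n + 1 \<le> 2 * 2 ^ n" for n :: nat
      proof (induction n)
        case (Suc n)
        moreover have "1 \<le> (2 :: nat) ^ n" by simp
        ultimately show ?case
          by (intro conjI; simp only: power_Suc mult_Suc mult_Suc_right; linarith)
      qed simp
      have "real (n * n) \<le> real (2 * 2 ^ n)" using * by (simp only: of_nat_le_iff)
      then show ?thesis by simp
    qed
    have lin: "real n \<le> 2 ^ n" for n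
      using of_nat_mono[OF less_imp_le[OF less_exp[of n]], where ?'a = real] by simp
    have mono: "m x y t \<le> m x y (2 * t)" for x y
      using t by (intro has_sum_mono[OF has_sum_path_gf has_sum_path_gf])
        (auto intro!: divide_right_mono power_mono)
    have "\<bar>m x y t * ln (m x y t)\<bar> \<le> K * m x y (2 * t)" for x y
    proof -
      let ?m = "m x y t"
      consider "?m = 0" | "1 \<le> ?m" | "0 < ?m" "?m < 1"
        using path_gf_nonneg[of t x y] t by fastforce
      then show ?thesis
      proof cases
        case 1
        then show ?thesis using K t by (simp add: path_gf_nonneg)
      next
        case 2
        then have "\<bar>?m * ln ?m\<bar> = ?m * ln ?m" by simp
        also have "\<dots> \<le> ?m * K"
        proof (intro mult_left_mono)
          have "ln ?m \<le> real degree_bound * t"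
            using ln_mono[of ?m "exp (real degree_bound * t)"] path_gf_le_exp[of t x y] t 2 by simp
          then show "ln ?m \<le> K" by (simp add: K_def)
        qed (use 2 in simp)
        also have "\<dots> \<le> K * m x y (2 * t)"
          using mono K by (simp add: mult.commute mult_left_mono)
        finally show ?thesis .
      next
        case 3
        have "((\<lambda>\<gamma>. t ^ length \<gamma> / fact (length \<gamma>) * - ln ?m) has_sum ?m * - ln ?m) (paths G x y)"
          using t by (intro has_sum_cmult_left has_sum_path_gf) simp
        moreover have "((\<lambda>\<gamma>. K * ((2 * t) ^ length \<gamma> / fact (length \<gamma>))) has_sum K * m x y (2 * t))
            (paths G x y)"
          using t by (intro has_sum_cmult_right has_sum_path_gf) simp
        moreover have "t ^ length \<gamma> / fact (length \<gamma>) * - ln ?m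
            \<le> K * ((2 * t) ^ length \<gamma> / fact (length \<gamma>))" if "\<gamma> \<in> paths G x y" for \<gamma>
        proof -
          let ?n = "length \<gamma>"
          have "ln (t ^ ?n / fact ?n) \<le> ln ?m"
            using path_gf_ge_term[OF _ that, of t] t 3 by (intro ln_mono) auto
          then have "- ln ?m \<le> ln (fact ?n) - ?n * ln t"
            using t by (simp add: ln_div ln_realpow)
          also have "ln (fact ?n :: real) \<le> ?n * ?n"
          proof -
            have "(fact ?n :: real) \<le> real ?n ^ ?n"
              using fact_le_power[of ?n, where ?'a = real] by simp
            also have "\<dots> \<le> exp (real ?n) ^ ?n"
              by (intro power_mono) (use exp_ge_add_one_self[of "real ?n"] in linarith, simp)
            also have "\<dots> = exp (real ?n * real ?n)"
              by (simp add: exp_of_nat_mult)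
            finally have "ln (fact ?n :: real) \<le> ln (exp (real ?n * real ?n))"
              by (intro ln_mono) auto
            then show ?thesis by simp
          qed
          also have "?n * ?n - ?n * ln t \<le> 2 * 2 ^ ?n + 2 ^ ?n * \<bar>ln t\<bar>"
          proof -
            have "- (?n * ln t) \<le> ?n * \<bar>ln t\<bar>"
              using mult_left_mono[of "- ln t" "\<bar>ln t\<bar>" "real ?n"] by simp
            also have "\<dots> \<le> 2 ^ ?n * \<bar>ln t\<bar>" using lin by (intro mult_right_mono) auto
            finally show ?thesis using quad[of ?n] by simp
          qed
          also have "\<dots> \<le> K * 2 ^ ?n"
            using t by (simp add: K_def algebra_simps)
          finally have "- ln ?m \<le> K * 2 ^ ?n" by simp
          then have "t ^ ?n / fact ?n * - ln ?m \<le> t ^ ?n / fact ?n * (K * 2 ^ ?n)"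
            using t by (intro mult_left_mono) auto
          then show ?thesis by (simp add: power_mult_distrib algebra_simps)
        qed
        ultimately have "?m * - ln ?m \<le> K * m x y (2 * t)"
          by (rule has_sum_mono)
        then show ?thesis using 3 by (simp add: abs_mult)
      qed
    qed
    then show thesis by (rule that)
  qed
qed

section \<open>The critical time solves its equation\<close>

text \<open>On \<open>{0..R}\<close> every term of the series is at most its value at \<open>R\<close>, so the M-test of
  Weierstrass applies.\<close>

lemma continuous_on_path_gf: "continuous_on {0..R} (m x y)"
proof (cases "0 \<le> R")
  case True
  have "uniform_limit {0..R} (\<lambda>X t. \<Sum>\<gamma>\<in>X. t ^ length \<gamma> / fact (length \<gamma>)) (m x y)
      (finite_subsets_at_top (paths G x y))"
    using True has_sum_path_gf[OF True, of x y]
    by (intro Weierstrass_m_test_general'[where M = "\<lambda>\<gamma>. R ^ length \<gamma> / fact (length \<gamma>)"])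
       (auto intro!: has_sum_path_gf divide_right_mono power_mono intro: has_sum_imp_summable)
  then show ?thesis
    by (rule uniform_limit_theorem[rotated]) (auto intro!: always_eventually continuous_intros)
qed simp

text \<open>A solution exists by the intermediate value theorem; the least one exists because the
  solutions in a compact interval form a compact set.\<close>

lemma path_gf_critical_time:
  assumes "critical_time G v w < \<infinity>"
  obtains T where "critical_time G v w = ereal T" "0 \<le> T" "m v w T = 1"
proof -
  obtain \<gamma> where \<gamma>: "\<gamma> \<in> paths G v w"
    using assms by (auto simp: critical_time_def split: if_splits)
  define S where "S = {t. 0 \<le> t \<and> m v w t = 1}"
  have "\<exists>R\<ge>0. 1 \<le> m v w R"
  proof (cases "\<gamma> = []")
    case True
    with \<gamma> have "m v w 0 = 1" by (auto simp: paths_def path_gf_at_0)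
    then show ?thesis by force
  next
    case False
    \<comment> \<open>At this time already the term of \<open>\<gamma>\<close> alone is at least \<open>1\<close>, because \<open>1 \<le> R\<close>.\<close>
    define R :: real where "R = fact (length \<gamma>)"
    have "R \<le> R ^ length \<gamma>"
      using False by (intro self_le_power) (auto simp: R_def fact_ge_1)
    then have "1 \<le> R ^ length \<gamma> / fact (length \<gamma>)" by (simp add: R_def)
    also have "\<dots> \<le> m v w R" using \<gamma> by (intro path_gf_ge_term) (auto simp: R_def)
    finally show ?thesis by (intro exI[of _ R]) (simp add: R_def)
  qed
  then obtain R where R: "0 \<le> R" "1 \<le> m v w R" by blast
  have "\<exists>t\<ge>0. t \<le> R \<and> m v w t = 1"
    using R continuous_on_path_gf by (intro IVT') (auto simp: path_gf_at_0)
  then obtain r where r: "0 \<le> r" "r \<le> R" "m v w r = 1" by blast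
  have "compact {t \<in> {0..R}. m v w t = 1}"
    using continuous_closed_preimage_constant[OF continuous_on_path_gf, of R v w 1]
    by (auto simp: compact_eq_bounded_closed intro: bounded_subset[of "{0..R}"])
  moreover have "{t \<in> {0..R}. m v w t = 1} \<noteq> {}" using r by auto
  ultimately obtain T where T: "0 \<le> T" "T \<le> R" "m v w T = 1"
      and min: "\<And>t. 0 \<le> t \<Longrightarrow> t \<le> R \<Longrightarrow> m v w t = 1 \<Longrightarrow> T \<le> t"
    using compact_attains_inf[of "{t \<in> {0..R}. m v w t = 1}"] by auto
  have "(LEAST t. 0 \<le> t \<and> m v w t = 1) = T"
  proof (rule Least_equality)
    show "T \<le> t" if "0 \<le> t \<and> m v w t = 1" for t
      using that min[of t] T by (cases "t \<le> R") auto
  qed (use T in auto)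
  with \<gamma> have "critical_time G v w = ereal T" by (auto simp: critical_time_def)
  with T that show thesis by blast
qed


section \<open>Invariance under automorphisms\<close>

lemma finite_parallel_edges: "finite {e \<in> edges G. ends G e = c}"
proof (cases "\<exists>e\<in>edges G. ends G e = c")
  case True
  have "set_ends c \<noteq> {}"
  proof (cases c)
    case (Undirected u)
    then show ?thesis by (cases u) simp
  qed simp
  then obtain x where x: "x \<in> set_ends c" by blast
  moreover have "x \<in> V" using True x ends_in_verts by auto
  moreover have "{e \<in> edges G. ends G e = c} \<subseteq> incident_edges G x"
    using x by (auto simp: incident_edges_def)
  ultimately show ?thesis using degree_le finite_subset by blast
next
  case False
  then have "{e \<in> edges G. ends G e = c} = {}" by blast
  then show ?thesis by (simp only: finite.emptyI)
qed

lemma automorphism_card_edges: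
  assumes "automorphism G \<phi>" "set_ends c \<subseteq> V"
  shows "card {e \<in> edges G. ends G e = map_ends \<phi> c} = card {e \<in> edges G. ends G e = c}"
proof (cases c)
  case (Directed x y)
  with assms show ?thesis by (simp add: automorphism_def)
next
  case (Undirected u)
  then show ?thesis using assms by (cases u) (simp add: automorphism_def)
qed

lemma automorphism_inv:
  assumes "automorphism G \<phi>"
  shows "automorphism G (inv_into V \<phi>)"
proof -
  have bij: "bij_betw \<phi> V V" using assms by (simp add: automorphism_def)
  have inv: "inv_into V \<phi> x \<in> V" "\<phi> (inv_into V \<phi> x) = x" if "x \<in> V" for x
    using bij that by (auto simp: bij_betw_def f_inv_into_f inv_into_into)
  show ?thesis
    unfolding automorphism_def
  proof (intro conjI[OF bij_betw_inv_into[OF bij]] ballI)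
    fix x y assume "x \<in> V" "y \<in> V"
    note x = inv[OF this(1)] and y = inv[OF this(2)]
    from assms x(1) y(1) have
      "card {e \<in> edges G. ends G e = Directed (\<phi> (inv_into V \<phi> x)) (\<phi> (inv_into V \<phi> y))} =
        card {e \<in> edges G. ends G e = Directed (inv_into V \<phi> x) (inv_into V \<phi> y)} \<and>
      card {e \<in> edges G. ends G e = Undirected (Upair (\<phi> (inv_into V \<phi> x)) (\<phi> (inv_into V \<phi> y)))} =
        card {e \<in> edges G. ends G e = Undirected (Upair (inv_into V \<phi> x) (inv_into V \<phi> y))}"
      unfolding automorphism_def by blast
    then show "card {e \<in> edges G. ends G e = Directed (inv_into V \<phi> x) (inv_into V \<phi> y)} =
        card {e \<in> edges G. ends G e = Directed x y} \<and>
      card {e \<in> edges G. ends G e = Undirected (Upair (inv_into V \<phi> x) (inv_into V \<phi> y))} =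
        card {e \<in> edges G. ends G e = Undirected (Upair x y)}"
      unfolding x(2) y(2) by metis
  qed
qed

text \<open>Parallel edges with given ends are as numerous as those with the image ends, so the
  vertex map lifts to an injection on the edges, and with it on the paths.\<close>

lemma automorphism_path_gf_le:
  assumes auto: "automorphism G \<phi>" and t: "0 \<le> t"
  shows "m x y t \<le> m (\<phi> x) (\<phi> y) t"
proof -
  have bij: "bij_betw \<phi> V V" using auto by (simp add: automorphism_def)
  let ?E = "\<lambda>c. {e \<in> edges G. ends G e = c}"
  have "\<forall>c. \<exists>h. set_ends c \<subseteq> V \<longrightarrow> bij_betw h (?E c) (?E (map_ends \<phi> c))"
    using finite_same_card_bij[OF finite_parallel_edges finite_parallel_edges
        automorphism_card_edges[OF auto, symmetric]] by blast
  from choice[OF this] obtain h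
    where h: "\<And>c. set_ends c \<subseteq> V \<Longrightarrow> bij_betw (h c) (?E c) (?E (map_ends \<phi> c))"
    by blast
  define \<Phi> where "\<Phi> e = h (ends G e) e" for e
  have \<Phi>: "\<Phi> e \<in> edges G" "ends G (\<Phi> e) = map_ends \<phi> (ends G e)" if "e \<in> edges G" for e
    using bij_betwE[OF h[OF ends_in_verts[OF that]]] that by (auto simp: \<Phi>_def)
  have inj: "inj_on \<Phi> (edges G)"
  proof (rule inj_onI)
    fix e e' assume e: "e \<in> edges G" "e' \<in> edges G" "\<Phi> e = \<Phi> e'"
    then have "map_ends \<phi> (ends G e) = map_ends \<phi> (ends G e')" using \<Phi> by metis
    moreover have "inj_on \<phi> (set_ends (ends G e) \<union> set_ends (ends G e'))"
      using bij e ends_in_verts by (meson Un_least bij_betw_def inj_on_subset)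
    ultimately have "ends G e = ends G e'"
      by (intro ends.inj_map_strong[of "ends G e" "ends G e'" \<phi> \<phi>]) (auto dest: inj_onD)
    with e bij_betw_imp_inj_on[OF h[OF ends_in_verts[OF e(1)]]] show "e = e'"
      by (auto simp: \<Phi>_def dest: inj_onD)
  qed
  have traverses: "traverses G (\<phi> x) (\<Phi> e) (\<phi> z)" if "traverses G x e z" for x e z
    using that \<Phi>[of e] by (auto simp: traverses_def)
  have path: "is_path G (\<phi> x) (map \<Phi> \<gamma>) (\<phi> y)" if "is_path G x \<gamma> y" for x \<gamma>
    using that bij by (induction \<gamma> arbitrary: x) (auto dest: traverses bij_betwE)
  have edges: "set \<gamma> \<subseteq> edges G" if "is_path G x \<gamma> y" for x \<gamma>
    using that by (induction \<gamma> arbitrary: x) (auto simp: traverses_def)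
  have "inj_on (map \<Phi>) (paths G x y)"
    using edges by (intro inj_on_mapI inj_on_subset[OF inj]) (auto simp: paths_def)
  then have "((\<lambda>\<gamma>. t ^ length \<gamma> / fact (length \<gamma>)) has_sum m x y t) (map \<Phi> ` paths G x y)"
    using has_sum_path_gf[OF t, of x y] by (simp add: has_sum_reindex o_def)
  then show ?thesis
    by (rule has_sum_mono2[OF _ has_sum_path_gf[OF t]]) (use path t in \<open>auto simp: paths_def\<close>)
qed

text \<open>The inverse of an automorphism is again one, which turns the inequality into an
  equality.\<close>

lemma automorphism_path_gf:
  assumes auto: "automorphism G \<phi>" and t: "0 \<le> t" and xy: "x \<in> V" "y \<in> V"
  shows "m (\<phi> x) (\<phi> y) t = m x y t"
proof (rule antisym)
  have "inv_into V \<phi> (\<phi> z) = z" if "z \<in> V" for z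
    using auto that bij_betw_inv_into_left unfolding automorphism_def by metis
  then show "m (\<phi> x) (\<phi> y) t \<le> m x y t"
    using automorphism_path_gf_le[OF automorphism_inv[OF auto] t, of "\<phi> x" "\<phi> y"] xy by simp
qed (rule automorphism_path_gf_le[OF auto t])

section \<open>Paths cut twice and convergence of the entropy sums\<close>

lemma has_sum_two_cuts:
  assumes "0 \<le> s" "0 \<le> t" "0 \<le> u"
  shows "((\<lambda>(x, y). m a x s * m x y t * m y b u) has_sum m a b (s + t + u)) (V \<times> V)"
proof (rule has_sum_Sigma_nonneg)
  show "((\<lambda>y. m a x s * m x y t * m y b u) has_sum m a x s * m x b (t + u)) V" for x
    unfolding mult.assoc using assms by (intro has_sum_cmult_right chapman_kolmogorov)
  show "((\<lambda>x. m a x s * m x b (t + u)) has_sum m a b (s + t + u)) V"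
    unfolding add.assoc using assms by (intro chapman_kolmogorov) auto
qed (use assms in \<open>simp add: path_gf_nonneg\<close>)

lemma summable_ln_fst:
  assumes "0 \<le> s" "0 \<le> t"
  shows "(\<lambda>y. m x y s * m y z t * ln (m x y s)) summable_on V"
proof -
  obtain K where K: "\<And>x y. \<bar>m x y s * ln (m x y s)\<bar> \<le> K * m x y (2 * s)"
    using path_gf_ln_bound[OF assms(1)] by blast
  have "(\<lambda>y. K * (m x y (2 * s) * m y z t)) summable_on V"
    using assms by (intro summable_on_cmult_right has_sum_imp_summable[OF chapman_kolmogorov]) auto
  then have "(\<lambda>y. norm (m x y s * m y z t * ln (m x y s))) summable_on V"
  proof (rule summable_on_comparison_test)
    fix y
    have "norm (m x y s * m y z t * ln (m x y s)) = \<bar>m x y s * ln (m x y s)\<bar> * m y z t"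
      using assms by (simp add: abs_mult path_gf_nonneg)
    also have "\<dots> \<le> K * m x y (2 * s) * m y z t"
      using K assms by (intro mult_right_mono) (auto simp: path_gf_nonneg)
    finally show "norm (m x y s * m y z t * ln (m x y s)) \<le> K * (m x y (2 * s) * m y z t)"
      by simp
  qed simp
  then show ?thesis by (rule abs_summable_summable)
qed

lemma summable_ln_middle:
  assumes "0 \<le> s" "0 \<le> t" "0 \<le> u"
  shows "(\<lambda>(x, y). m a x s * m x y t * m y b u * ln (m x y t)) summable_on V \<times> V"
proof -
  obtain K where K: "\<And>x y. \<bar>m x y t * ln (m x y t)\<bar> \<le> K * m x y (2 * t)"
    using path_gf_ln_bound[OF assms(2)] by blast
  have "(\<lambda>p. K * (case p of (x, y) \<Rightarrow> m a x s * m x y (2 * t) * m y b u)) summable_on V \<times> V"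
    using assms by (intro summable_on_cmult_right has_sum_imp_summable[OF has_sum_two_cuts]) auto
  then have "(\<lambda>p. norm (case p of (x, y) \<Rightarrow> m a x s * m x y t * m y b u * ln (m x y t)))
      summable_on V \<times> V"
  proof (rule summable_on_comparison_test)
    fix p :: "'v \<times> 'v"
    obtain x y where p: "p = (x, y)" by (cases p)
    have "norm (m a x s * m x y t * m y b u * ln (m x y t))
        = m a x s * m y b u * \<bar>m x y t * ln (m x y t)\<bar>"
      using assms by (simp add: abs_mult path_gf_nonneg)
    also have "\<dots> \<le> m a x s * m y b u * (K * m x y (2 * t))"
      using K assms by (intro mult_left_mono) (auto simp: path_gf_nonneg)
    finally show "norm (case p of (x, y) \<Rightarrow> m a x s * m x y t * m y b u * ln (m x y t))
        \<le> K * (case p of (x, y) \<Rightarrow> m a x s * m x y (2 * t) * m y b u)"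
      by (simp add: p algebra_simps)
  qed simp
  then show ?thesis by (rule abs_summable_summable)
qed

end

section \<open>The bridge of a symmetric pair\<close>

locale reflected_pair = bounded_degree_graph G
  for G :: "('v, 'e) mixed_graph" +
  fixes v w :: 'v and \<sigma> :: "'v \<Rightarrow> 'v" and T :: real
  assumes v_in: "v \<in> verts G" and w_in: "w \<in> verts G"
    and bij_\<sigma>: "bij_betw \<sigma> (verts G) (verts G)"
    and swap_start: "\<And>x. x \<in> verts G \<Longrightarrow> pair_equiv G (v, x) (\<sigma> x, w)"
    and swap_end: "\<And>x. x \<in> verts G \<Longrightarrow> pair_equiv G (x, w) (v, \<sigma> x)"
    and T_nonneg: "0 \<le> T" and total_mass: "path_gf G v w T = 1"
begin

lemma \<sigma>_in: "x \<in> V \<Longrightarrow> \<sigma> x \<in> V"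
  using bij_\<sigma> by (rule bij_betw_apply)

lemma path_gf_\<sigma>:
  assumes "x \<in> V" "0 \<le> t"
  shows "m (\<sigma> x) w t = m v x t" and "m v (\<sigma> x) t = m x w t"
proof -
  obtain \<phi> where "automorphism G \<phi>" "\<phi> v = \<sigma> x" "\<phi> x = w"
    using swap_start[OF assms(1)] by (auto simp: pair_equiv_def)
  then show "m (\<sigma> x) w t = m v x t"
    using automorphism_path_gf[of \<phi> t v x] assms v_in by simp
  obtain \<phi> where "automorphism G \<phi>" "\<phi> x = v" "\<phi> w = \<sigma> x"
    using swap_end[OF assms(1)] by (auto simp: pair_equiv_def)
  then show "m v (\<sigma> x) t = m x w t"
    using automorphism_path_gf[of \<phi> t x w] assms w_in by simp
qed

text \<open>The expected value of \<open>ln (m v Y t)\<close>, where \<open>Y\<close> is the position at time \<open>t\<close> of the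
  bridge from \<open>v\<close> to \<open>w\<close>.\<close>

definition log_mean :: "real \<Rightarrow> real" where
  "log_mean t = (\<Sum>\<^sub>\<infinity>y\<in>V. m v y t * m y w (T - t) * ln (m v y t))"

lemma has_sum_log_mean:
  assumes "0 \<le> t" "t \<le> T"
  shows "((\<lambda>y. m v y t * m y w (T - t) * ln (m v y t)) has_sum log_mean t) V"
  unfolding log_mean_def using assms by (intro has_sum_infsum summable_ln_fst) auto

text \<open>Seen through \<open>\<sigma>\<close>, the last \<open>t\<close> units of time of the bridge look like the first
  ones.\<close>

lemma has_sum_log_mean_reversed:
  assumes "0 \<le> t" "t \<le> T"
  shows "((\<lambda>x. m v x (T - t) * m x w t * ln (m x w t)) has_sum log_mean t) V"
proof -
  have "((\<lambda>x. m v (\<sigma> x) t * m (\<sigma> x) w (T - t) * ln (m v (\<sigma> x) t)) has_sum log_mean t) V"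
    using has_sum_log_mean[OF assms] by (rule has_sum_reindex_bij_betw[OF bij_\<sigma>, THEN iffD2])
  then show ?thesis
    by (rule has_sum_cong[THEN iffD1, rotated]) (use assms in \<open>simp add: path_gf_\<sigma>\<close>)
qed

text \<open>Stationarity of the bridge.  The window of length \<open>t\<close> at the start is moved to the right
  by \<open>s\<close>: mark the position \<open>z\<close> that the bridge has at time \<open>T - s\<close>, and exchange the piece
  \<open>v \<rightarrow> z\<close>, which contains the window, with the piece \<open>z \<rightarrow> w\<close> of duration \<open>s\<close>.  The sum over
  the inside of the first piece is invariant under automorphisms.\<close>

lemma has_sum_log_mean_middle:
  assumes s: "0 \<le> s" and t: "0 \<le> t" and u: "0 \<le> u" and T: "s + t + u = T"
  shows "((\<lambda>(x, y). m v x s * m x y t * m y w u * ln (m x y t)) has_sum log_mean t) (V \<times> V)"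
proof -
  \<comment> \<open>The contribution of a piece from \<open>a\<close> to \<open>b\<close> of duration \<open>t + u\<close> whose first \<open>t\<close> units
    of time are the window.\<close>
  define K where "K a b = (\<Sum>\<^sub>\<infinity>y\<in>V. m a y t * m y b u * ln (m a y t))" for a b
  have K: "((\<lambda>y. m a y t * m y b u * ln (m a y t)) has_sum K a b) V" for a b
    unfolding K_def using t u by (intro has_sum_infsum summable_ln_fst)
  have K_\<sigma>: "K (\<sigma> z) w = K v z" if z: "z \<in> V" for z
  proof -
    obtain \<phi> where \<phi>: "automorphism G \<phi>" "\<phi> v = \<sigma> z" "\<phi> z = w"
      using swap_start[OF z] by (auto simp: pair_equiv_def)
    then have bij: "bij_betw \<phi> V V" by (simp add: automorphism_def)
    have "((\<lambda>y. m (\<phi> v) (\<phi> y) t * m (\<phi> y) (\<phi> z) u * ln (m (\<phi> v) (\<phi> y) t)) has_sum K (\<sigma> z) w) V"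
      unfolding \<phi>(2,3) using K[of "\<sigma> z" w] by (rule has_sum_reindex_bij_betw[OF bij, THEN iffD2])
    then have "((\<lambda>y. m v y t * m y z u * ln (m v y t)) has_sum K (\<sigma> z) w) V"
      by (rule has_sum_cong[THEN iffD1, rotated])
         (use automorphism_path_gf[OF \<phi>(1)] t u z v_in in simp)
    with K[of v z] show ?thesis by (rule has_sum_unique[symmetric])
  qed
  have "((\<lambda>(y, z). m v y t * m y z u * m z w s * ln (m v y t)) has_sum log_mean t) (V \<times> V)"
  proof -
    have rest: "T - t = u + s" using T by simp
    then have H: "((\<lambda>y. m v y t * m y w (u + s) * ln (m v y t)) has_sum log_mean t) V"
      using has_sum_log_mean[of t, unfolded rest] s t u T by simp
    have "((\<lambda>z. m v y t * m y z u * m z w s) has_sum m v y t * m y w (u + s)) V" for y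
      unfolding mult.assoc using s u by (intro has_sum_cmult_right chapman_kolmogorov)
    from has_sum_marginal[OF this _ has_sum_imp_summable[OF H]]
    show ?thesis using s t u infsumI[OF H] by (simp add: path_gf_nonneg)
  qed
  then have swapped: "((\<lambda>(z, y). m v y t * m y z u * m z w s * ln (m v y t)) has_sum log_mean t) (V \<times> V)"
    by (subst (asm) has_sum_swap) simp
  have inner: "((\<lambda>y. m v y t * m y z u * m z w s * ln (m v y t)) has_sum m z w s * K v z) V" for z
    using has_sum_cmult_right[OF K[of v z], of "m z w s"] by (simp add: mult_ac)
  have "((\<lambda>z. m z w s * K v z) has_sum log_mean t) V"
    by (rule has_sum_SigmaD[OF swapped]) (simp only: prod.case, rule inner)
  then have "((\<lambda>z. m v (\<sigma> z) s * K (\<sigma> z) w) has_sum log_mean t) V"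
    by (rule has_sum_cong[THEN iffD1, rotated]) (use s in \<open>simp add: path_gf_\<sigma> K_\<sigma>\<close>)
  then have iterated: "((\<lambda>x. m v x s * K x w) has_sum log_mean t) V"
    by (subst (asm) has_sum_reindex_bij_betw[OF bij_\<sigma>])
  show ?thesis
  proof (rule has_sum_SigmaI)
    show "((\<lambda>y. case (x, y) of (x, y) \<Rightarrow> m v x s * m x y t * m y w u * ln (m x y t)) has_sum
        m v x s * K x w) V" for x
      using has_sum_cmult_right[OF K[of x w], of "m v x s"] by (simp add: mult_ac)
  qed (use iterated summable_ln_middle s t u in auto)
qed

text \<open>In the joint law of the positions at two times, a function of one position is averaged with
  the marginal law of that position.  With windows that start at time \<open>0\<close> or end at time \<open>T\<close>
  this yields \<open>log_mean\<close> as a sum over the joint law.\<close>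

lemma has_sum_ln_outer:
  assumes "0 \<le> s" "0 \<le> t" "0 \<le> u" "s + t + u = T"
  shows "((\<lambda>(x, y). m v x s * m x y t * m y w u * ln (m v x s)) has_sum log_mean s) (V \<times> V)"
    and "((\<lambda>(x, y). m v x s * m x y t * m y w u * ln (m x w (t + u))) has_sum log_mean (t + u)) (V \<times> V)"
proof -
  have T: "T - s = t + u" "T - (t + u) = s" using assms by auto
  have marg: "((\<lambda>y. m v x s * m x y t * m y w u) has_sum m v x s * m x w (t + u)) V" for x
    unfolding mult.assoc using assms by (intro has_sum_cmult_right chapman_kolmogorov)
  have H: "((\<lambda>x. m v x s * m x w (t + u) * ln (m v x s)) has_sum log_mean s) V"
    using has_sum_log_mean[of s] assms T by simp
  show "((\<lambda>(x, y). m v x s * m x y t * m y w u * ln (m v x s)) has_sum log_mean s) (V \<times> V)"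
    using has_sum_marginal[OF marg _ has_sum_imp_summable[OF H]] infsumI[OF H] assms
    by (simp add: path_gf_nonneg)
  have H: "((\<lambda>x. m v x s * m x w (t + u) * ln (m x w (t + u))) has_sum log_mean (t + u)) V"
    using has_sum_log_mean_reversed[of "t + u"] assms T by simp
  show "((\<lambda>(x, y). m v x s * m x y t * m y w u * ln (m x w (t + u))) has_sum log_mean (t + u)) (V \<times> V)"
    using has_sum_marginal[OF marg _ has_sum_imp_summable[OF H]] infsumI[OF H] assms
    by (simp add: path_gf_nonneg)
qed

lemma has_sum_ln_last:
  assumes "0 \<le> s" "0 \<le> t" "0 \<le> u" "s + t + u = T"
  shows "((\<lambda>(x, y). m v x s * m x y t * m y w u * ln (m v y (s + t))) has_sum log_mean (s + t)) (V \<times> V)"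
proof -
  have T: "T - (s + t) = u" using assms by auto
  have marg: "((\<lambda>x. m v x s * m x y t * m y w u) has_sum m v y (s + t) * m y w u) V" for y
    using assms by (intro has_sum_cmult_left chapman_kolmogorov)
  have H: "((\<lambda>y. m v y (s + t) * m y w u * ln (m v y (s + t))) has_sum log_mean (s + t)) V"
    using has_sum_log_mean[of "s + t"] assms T by simp
  show ?thesis
    using has_sum_marginal_snd[OF marg _ has_sum_imp_summable[OF H]] infsumI[OF H] assms
    by (simp add: path_gf_nonneg)
qed

text \<open>The paths \<open>v \<rightarrow> y\<close> that pass through \<open>x\<close> at the right time are among all paths
  \<open>v \<rightarrow> y\<close>; this is an inequality for every pair \<open>(x, y)\<close>, not only on average.\<close>

lemma log_mean_superadditive:
  assumes "0 \<le> a" "0 \<le> b" "a + b \<le> T"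
  shows "log_mean a + log_mean b \<le> log_mean (a + b)"
proof (rule has_sum_mono)
  define u where "u = T - (a + b)"
  have u: "0 \<le> u" "a + b + u = T" using assms by (auto simp: u_def)
  let ?W = "\<lambda>x y. m v x a * m x y b * m y w u"
  show "((\<lambda>p. (case p of (x, y) \<Rightarrow> ?W x y * ln (m v x a)) + (case p of (x, y) \<Rightarrow> ?W x y * ln (m x y b)))
      has_sum log_mean a + log_mean b) (V \<times> V)"
    using assms u by (intro has_sum_add has_sum_ln_outer has_sum_log_mean_middle)
  show "((\<lambda>(x, y). ?W x y * ln (m v y (a + b))) has_sum log_mean (a + b)) (V \<times> V)"
    using assms u by (intro has_sum_ln_last)
  fix p assume "p \<in> V \<times> V"
  then obtain x y where p: "p = (x, y)" "x \<in> V" "y \<in> V" by blast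
  have "?W x y * (ln (m v x a) + ln (m x y b)) \<le> ?W x y * ln (m v y (a + b))"
  proof (cases "?W x y = 0")
    case False
    then have pos: "0 < m v x a" "0 < m x y b" and W: "0 \<le> ?W x y"
      using path_gf_nonneg assms u by (auto simp: less_le)
    have "ln (m v x a) + ln (m x y b) = ln (m v x a * m x y b)"
      using pos by (simp add: ln_mult)
    also have "\<dots> \<le> ln (m v y (a + b))"
      using pos path_gf_mult_le[OF assms(1,2) p(2), of v y] by (intro ln_mono) auto
    finally show ?thesis using W by (rule mult_left_mono)
  next
    case True
    then show ?thesis by (simp only: mult_zero_left order_refl)
  qed
  then show "(case p of (x, y) \<Rightarrow> ?W x y * ln (m v x a)) + (case p of (x, y) \<Rightarrow> ?W x y * ln (m x y b))
      \<le> (case p of (x, y) \<Rightarrow> ?W x y * ln (m v y (a + b)))"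
    by (simp add: p distrib_left)
qed

text \<open>Nonnegativity of a mutual information, by \<open>ln r \<le> r - 1\<close>: if \<open>W\<close> is the joint law of the
  positions \<open>x\<close> at time \<open>T - b\<close> and \<open>y\<close> at time \<open>a\<close>, and \<open>P\<close> the product of its marginals,
  then \<open>P / W\<close> is \<open>r = m v y a * m x w b / m x y (a + b - T)\<close>.  The total mass of \<open>W\<close> is
  \<open>m v w T\<close> and that of \<open>P\<close> is its square; the argument needs the second not to exceed the first,
  and \<open>m v w T = 1\<close> makes them equal.\<close>

lemma log_mean_superadditive_wrapped:
  assumes ab: "0 \<le> a" "a \<le> T" "0 \<le> b" "b \<le> T" "T \<le> a + b"
  shows "log_mean a + log_mean b \<le> log_mean (a + b - T)"
proof -
  define s t u where "s = T - b" and "t = a + b - T" and "u = T - a"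
  have stu: "0 \<le> s" "0 \<le> t" "0 \<le> u" "s + t + u = T" "s + t = a" "t + u = b" "s + b = T" "a + u = T"
    using ab by (auto simp: s_def t_def u_def)
  let ?W = "\<lambda>x y. m v x s * m x y t * m y w u"
  let ?P = "\<lambda>x y. (m v x s * m x w b) * (m v y a * m y w u)"
  have "log_mean a + log_mean b + 1 \<le> log_mean t + 1"
  proof (rule has_sum_mono)
    show "((\<lambda>p. (case p of (x, y) \<Rightarrow> ?W x y * ln (m v y a)) + (case p of (x, y) \<Rightarrow> ?W x y * ln (m x w b))
        + (case p of (x, y) \<Rightarrow> ?W x y)) has_sum log_mean a + log_mean b + 1) (V \<times> V)"
      using has_sum_ln_last[OF stu(1-4), unfolded stu(5)] has_sum_ln_outer(2)[OF stu(1-4), unfolded stu(6)]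
        has_sum_two_cuts[OF stu(1-3), of v w, unfolded stu(4) total_mass]
      by (intro has_sum_add)
    have "((\<lambda>(x, y). ?P x y) has_sum 1) (V \<times> V)"
    proof (rule has_sum_Sigma_nonneg)
      show "((\<lambda>y. ?P x y) has_sum m v x s * m x w b) V" for x
        using has_sum_cmult_right[OF chapman_kolmogorov[of a u v w], of "m v x s * m x w b"] stu
          total_mass ab by simp
      show "((\<lambda>x. m v x s * m x w b) has_sum 1) V"
        using chapman_kolmogorov[of s b v w] stu total_mass ab by simp
    qed (use stu ab in \<open>simp add: path_gf_nonneg\<close>)
    then show "((\<lambda>p. (case p of (x, y) \<Rightarrow> ?W x y * ln (m x y t)) + (case p of (x, y) \<Rightarrow> ?P x y))
        has_sum log_mean t + 1) (V \<times> V)"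
      using stu by (intro has_sum_add has_sum_log_mean_middle)
    fix p assume "p \<in> V \<times> V"
    then obtain x y where p: "p = (x, y)" "x \<in> V" "y \<in> V" by blast
    have "?W x y * (ln (m v y a) + ln (m x w b) + 1) \<le> ?W x y * ln (m x y t) + ?P x y"
    proof (cases "?W x y = 0")
      case True
      have "0 \<le> ?P x y" using stu ab by (simp add: path_gf_nonneg)
      then show ?thesis by (simp only: True mult_zero_left add_0_left)
    next
      case False
      then have pos: "0 < m v x s" "0 < m x y t" "0 < m y w u" and W: "0 \<le> ?W x y"
        using path_gf_nonneg stu by (auto simp: less_le)
      have "0 < m v x s * m x y t" "0 < m x y t * m y w u" using pos by simp_all
      then have pos': "0 < m v y a" "0 < m x w b"
        using path_gf_mult_le[OF stu(1,2) p(2), of v y] path_gf_mult_le[OF stu(2,3) p(3), of x w] stu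
        by auto
      define r where "r = m v y a * m x w b / m x y t"
      have "ln r \<le> r - 1"
        using pos pos' by (intro ln_le_minus_one) (simp add: r_def)
      moreover have "ln r = ln (m v y a) + ln (m x w b) - ln (m x y t)"
        using pos pos' by (simp add: r_def ln_div ln_mult)
      ultimately have "?W x y * (ln (m v y a) + ln (m x w b) + 1) \<le> ?W x y * (ln (m x y t) + r)"
        using W by (intro mult_left_mono) auto
      also have "\<dots> = ?W x y * ln (m x y t) + ?P x y"
        using pos by (simp add: r_def field_simps)
      finally show ?thesis .
    qed
    then show "(case p of (x, y) \<Rightarrow> ?W x y * ln (m v y a)) + (case p of (x, y) \<Rightarrow> ?W x y * ln (m x w b))
        + (case p of (x, y) \<Rightarrow> ?W x y)
      \<le> (case p of (x, y) \<Rightarrow> ?W x y * ln (m x y t)) + (case p of (x, y) \<Rightarrow> ?P x y)"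
      by (simp add: p distrib_left)
  qed
  then show ?thesis by (simp add: t_def)
qed

lemma log_mean_bounded:
  assumes t: "0 \<le> t" "t \<le> T"
  shows "log_mean t \<le> real degree_bound * T"
proof (rule has_sum_mono[OF has_sum_log_mean[OF t]])
  show "((\<lambda>y. m v y t * m y w (T - t) * (real degree_bound * T)) has_sum real degree_bound * T) V"
    using has_sum_cmult_left[OF chapman_kolmogorov[of t "T - t" v w], of "real degree_bound * T"] t total_mass
    by simp
  fix y
  have "ln (m v y t) \<le> real degree_bound * T"
  proof (cases "m v y t = 0")
    case False
    then have "0 < m v y t" using path_gf_nonneg[OF t(1), of v y] by simp
    then have "ln (m v y t) \<le> ln (exp (real degree_bound * t))"
      using path_gf_le_exp[OF t(1), of v y] by (intro ln_mono) auto
    also have "\<dots> \<le> real degree_bound * T" using t by (simp add: mult_left_mono)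
    finally show ?thesis .
  qed (use T_nonneg in simp)
  then show "m v y t * m y w (T - t) * ln (m v y t) \<le> m v y t * m y w (T - t) * (real degree_bound * T)"
    using t by (intro mult_left_mono) (auto simp: path_gf_nonneg)
qed

lemma log_mean_nonpos:
  assumes t: "0 \<le> t" "t \<le> T"
  shows "log_mean t \<le> 0"
proof -
  have halving: "log_mean t \<le> real degree_bound * T * (1 / 2) ^ n" if "0 \<le> t" "t \<le> T" for t n
    using that
  proof (induction n arbitrary: t)
    case 0
    then show ?case using log_mean_bounded by simp
  next
    case (Suc n)
    \<comment> \<open>Doubling modulo \<open>T\<close>.\<close>
    define t' where "t' = (if t + t \<le> T then t + t else t + t - T)"
    have "0 \<le> t'" "t' \<le> T" using Suc.prems by (auto simp: t'_def)
    moreover have "log_mean t + log_mean t \<le> log_mean t'"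
      using Suc.prems log_mean_superadditive[of t t] log_mean_superadditive_wrapped[of t t]
      by (auto simp: t'_def)
    ultimately show ?case using Suc.IH[of t'] by simp
  qed
  have "(\<lambda>n. real degree_bound * T * (1 / 2) ^ n) \<longlonglongrightarrow> real degree_bound * T * 0"
    by (intro tendsto_mult_left LIMSEQ_power_zero) simp
  then show ?thesis
    using halving[OF t] by (intro LIMSEQ_le_const) auto
qed

end

section \<open>Nonpositivity of the entropy sum\<close>

theorem proposition1p5:
  fixes G :: "('v, 'e) mixed_graph" and v w :: 'v and \<sigma> :: "'v \<Rightarrow> 'v"
  assumes "bounded_degree_graph G"
    and "v \<in> verts G" and "w \<in> verts G"
    and "critical_time G v w < \<infinity>"
    and "bij_betw \<sigma> (verts G) (verts G)"
    and "\<And>x. x \<in> verts G \<Longrightarrow> pair_equiv G (v, x) (\<sigma> x, w)"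
    and "\<And>x. x \<in> verts G \<Longrightarrow> pair_equiv G (x, w) (v, \<sigma> x)"
  shows "\<forall>s t :: real. 0 \<le> s \<and> 0 \<le> t \<and> ereal (s + t) \<le> critical_time G v w
           \<longrightarrow> entropy_sum G v w s t \<le> 0"
proof (intro allI impI, elim conjE)
  fix s t :: real
  assume s: "0 \<le> s" and t: "0 \<le> t" and "ereal (s + t) \<le> critical_time G v w"
  moreover obtain T where T: "critical_time G v w = ereal T" "0 \<le> T" "path_gf G v w T = 1"
    using bounded_degree_graph.path_gf_critical_time[OF assms(1,4)] by blast
  ultimately have le: "s + t \<le> T" by simp
  interpret reflected_pair G v w \<sigma> T
    using assms T by (intro reflected_pair.intro reflected_pair_axioms.intro) auto
  have "entropy_sum G v w s t = log_mean t"
    unfolding entropy_sum_def T(1) using s t le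
    by (intro infsumI) (auto intro!: has_sum_log_mean_middle)
  also have "\<dots> \<le> 0" using t le s by (intro log_mean_nonpos) auto
  finally show "entropy_sum G v w s t \<le> 0" .
qed

end
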